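(* Let $m,n$ be integers with $1\le m<n/2$, $m$ constant, and $q$ a prime power with $q\to\infty$, and suppose $n=o(q^m(\log q)^{-1})$. Let $X$ be the random set of points of $\mathbb{F}_q^n$ containing each point independently with probability $\theta$. Then the event that $X$ is an $m$-blocking set has threshold $nq^{-m}\log q$, i.e. its probability tends to $0$ if $\theta=o(nq^{-m}\log q)$ and tends to $1$ if $\theta=\omega(nq^{-m}\log q)$.
   Context: An $m$-flat in $\mathbb{F}_q^n$ is a translate of an $m$-dimensional linear subspace. A set of points in $\mathbb{F}_q^n$ is an $m$-blocking set if it intersects every $m$-flat. *)

theory Defs
  imports
    "Jordan_Normal_Form.Missing_VectorSpace"
    "HOL-Algebra.AbelCoset"
    "HOL-Probability.Probability"
    "HOL-Library.Landau_Symbols"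
    "HOL-Number_Theory.Prime_Powers"
begin

text \<open>
  The order of the field and the dimension both vary along a sequence, so finite fields are
  rings in the sense of HOL-Algebra and the space of n-tuples over \<open>K\<close> is the vector space
  of extensional functions from \<open>{..<n}\<close> to the carrier of \<open>K\<close>.
\<close>

definition coord_space :: "('a, 'b) ring_scheme \<Rightarrow> nat \<Rightarrow> ('a, nat \<Rightarrow> 'a) module" where
  "coord_space K n = ring.func_space K {..<n}"

definition flat :: "('a, 'b) ring_scheme \<Rightarrow> nat \<Rightarrow> nat \<Rightarrow> (nat \<Rightarrow> 'a) set \<Rightarrow> bool" where
  "flat K n m S \<longleftrightarrow>
    (\<exists>W a. VectorSpace.subspace K W (coord_space K n)
         \<and> vectorspace.dim K ((coord_space K n)\<lparr>carrier := W\<rparr>) = m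
         \<and> a \<in> carrier (coord_space K n)
         \<and> S = a <+\<^bsub>coord_space K n\<^esub> W)"

definition blocking_set :: "('a, 'b) ring_scheme \<Rightarrow> nat \<Rightarrow> nat \<Rightarrow> (nat \<Rightarrow> 'a) set \<Rightarrow> bool" where
  "blocking_set K n m X \<longleftrightarrow>
    X \<subseteq> carrier (coord_space K n) \<and> (\<forall>S. flat K n m S \<longrightarrow> X \<inter> S \<noteq> {})"

text \<open>Meaningful for finite \<open>A\<close> and \<open>0 \<le> \<theta> \<le> 1\<close> only, as for \<^const>\<open>Pi_pmf\<close> and \<^const>\<open>bernoulli_pmf\<close>.\<close>

definition random_subset :: "'a set \<Rightarrow> real \<Rightarrow> 'a set pmf" where
  "random_subset A \<theta> =
    map_pmf (\<lambda>b. {x \<in> A. b x}) (Pi_pmf A False (\<lambda>_. bernoulli_pmf \<theta>))"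

end

theory Submission
  imports Defs "HOL-Real_Asymp.Real_Asymp"
begin

text \<open>
  An \<open>m\<close>-flat has \<open>q\<^sup>m\<close> points, so \<open>X\<close> misses it with probability \<open>(1 - \<theta>)\<close> to the power \<open>q\<^sup>m\<close>.
  There are at most \<open>q\<close> to the power \<open>n (m + 1)\<close> flats (a point and a basis of the direction),
  and a union bound gives the upper half of the threshold. For the lower half, the cosets of a
  single \<open>m\<close>-dimensional subspace already suffice: they are disjoint, so the events that
  \<open>X\<close> meets them are independent, and there are \<open>q\<close> to the power \<open>n - m \<ge> n / 2\<close> of them, which
  outweighs the factor \<open>exp (- o(n log q))\<close> by which each is missed. The hypothesis on \<open>n\<close> makes
  \<open>\<theta>\<close> small there, so that \<open>1 - \<theta>\<close> is at least \<open>exp (- 2 \<theta>)\<close>.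
\<close>

section \<open>Counting in finite vector spaces\<close>

text \<open>Coordinates with respect to a finite basis \<open>B\<close> identify the space with the
  extensional functions from \<open>B\<close> to the field.\<close>

lemma (in vectorspace) card_carrier_eq_power_dim:
  assumes "fin_dim"
  shows "card (carrier V) = card (carrier K) ^ dim"
proof -
  obtain B where B: "finite B" "basis B"
    using finite_basis_exists[OF assms] by blast
  have BV: "B \<subseteq> carrier V" using B(2) by (simp add: basis_def)
  have ex1: "\<forall>v. v \<in> carrier V \<longrightarrow> (\<exists>!a. a \<in> B \<rightarrow>\<^sub>E carrier K \<and> lincomb a B = v)"
    using basis_criterion[OF B(1) BV] B(2) by simp
  have closed: "lincomb a B \<in> carrier V" if "a \<in> B \<rightarrow>\<^sub>E carrier K" for a
    using that BV by (intro lincomb_closed) auto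
  have "bij_betw (\<lambda>a. lincomb a B) (B \<rightarrow>\<^sub>E carrier K) (carrier V)"
    unfolding bij_betw_def
  proof
    show "inj_on (\<lambda>a. lincomb a B) (B \<rightarrow>\<^sub>E carrier K)"
      using ex1 closed unfolding inj_on_def by metis
    show "(\<lambda>a. lincomb a B) ` (B \<rightarrow>\<^sub>E carrier K) = carrier V"
      using ex1 closed by (auto simp: image_iff)
  qed
  then have "card (carrier V) = card (B \<rightarrow>\<^sub>E carrier K)"
    by (simp add: bij_betw_same_card)
  then show ?thesis
    using B by (simp add: card_PiE dim_basis)
qed

lemma (in vectorspace) finite_imp_fin_dim:
  assumes "finite (carrier V)"
  shows "fin_dim"
  unfolding fin_dim_def
proof (intro exI[of _ "carrier V"] conjI assms subset_refl)
  show "span (carrier V) = carrier V"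
    using span_mem[OF subset_refl] span_closed[OF subset_refl] by blast
qed

text \<open>Serves in both directions: it gives the size of a flat, and it recovers a dimension from
  a number of elements.\<close>

lemma (in vectorspace) card_subspace_eq_power_dim:
  assumes "finite (carrier V)" "VectorSpace.subspace K W V"
  shows "card W = card (carrier K) ^ vectorspace.dim K (vs W)"
proof -
  interpret W: vectorspace K "vs W" by (rule subspace_is_vs[OF assms(2)])
  have "W \<subseteq> carrier V" using is_module[OF assms(2)] by (simp add: submodule_def)
  then have "finite W" using assms(1) finite_subset by blast
  then have "W.fin_dim" by (intro W.finite_imp_fin_dim) simp
  from W.card_carrier_eq_power_dim[OF this] show ?thesis by simp
qed

text \<open>Each such subspace is the span of some \<open>d\<close>-element set of vectors, so a
  binomial coefficient bounds their number.\<close>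

lemma (in vectorspace) card_subspaces_le:
  assumes "finite (carrier V)"
  shows "card {W. VectorSpace.subspace K W V \<and> vectorspace.dim K (vs W) = d} \<le> card (carrier V) ^ d"
proof -
  let ?B = "{B. B \<subseteq> carrier V \<and> card B = d}"
  have "{W. VectorSpace.subspace K W V \<and> vectorspace.dim K (vs W) = d} \<subseteq> span ` ?B"
  proof (intro subsetI, elim CollectE conjE)
    fix W assume W: "VectorSpace.subspace K W V" "vectorspace.dim K (vs W) = d"
    interpret W: vectorspace K "vs W" by (rule subspace_is_vs[OF W(1)])
    have sub: "W \<subseteq> carrier V" using is_module[OF W(1)] by (simp add: submodule_def)
    then have "finite W" using assms finite_subset by blast
    then have "W.fin_dim" by (intro W.finite_imp_fin_dim) simp
    then obtain B where B: "finite B" "W.basis B" using W.finite_basis_exists by blast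
    then have "B \<subseteq> W" "W.span B = W" by (auto simp: W.basis_def)
    \<comment> \<open>The span must not depend on the ambient space, so that the single map
      \<open>span\<close> covers all choices of \<open>W\<close>.\<close>
    moreover have "W.span B = span B"
      using span_li_not_depend(1)[OF \<open>B \<subseteq> W\<close> is_module[OF W(1)]] .
    moreover have "card B = d" using W.dim_basis[OF B] W(2) by simp
    ultimately show "W \<in> span ` ?B" using sub by blast
  qed
  moreover have "finite ?B" using assms by simp
  ultimately have "card {W. VectorSpace.subspace K W V \<and> vectorspace.dim K (vs W) = d} \<le> card ?B"
    by (meson card_image_le card_mono finite_imageI le_trans)
  also have "card ?B = card (carrier V) choose d"
    using n_subsets[OF assms] by simp
  also have "\<dots> \<le> card (carrier V) ^ d"
    \<comment> \<open>For \<open>d\<close> above the size of the space the binomial coefficient is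
      0.\<close>
    by (cases "d \<le> card (carrier V)") (simp_all add: binomial_le_pow binomial_eq_0)
  finally show ?thesis .
qed

lemma (in abelian_group) card_a_l_coset:
  assumes "a \<in> carrier G" "W \<subseteq> carrier G"
  shows "card (a <+\<^bsub>G\<^esub> W) = card W"
proof -
  have "inj_on (\<lambda>w. a \<oplus>\<^bsub>G\<^esub> w) W"
    using assms by (intro inj_onI) (metis a_comm add.right_cancel subsetD)
  moreover have "a <+\<^bsub>G\<^esub> W = (\<lambda>w. a \<oplus>\<^bsub>G\<^esub> w) ` W"
    by (auto simp: a_l_coset_def')
  ultimately show ?thesis by (simp add: card_image)
qed

section \<open>Flats of the coordinate space over a finite field\<close>

context
  fixes K :: "('a, 'b) ring_scheme" (structure)
  assumes K: "field K"
begin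

interpretation K: field K by (rule K)

lemma vectorspace_coord_space: "vectorspace K (coord_space K n)"
proof -
  have "Module.module K (coord_space K n)"
    unfolding coord_space_def by (rule K.func_space_is_module)
  then show ?thesis using K by (simp add: vectorspace_def)
qed

lemma carrier_coord_space: "carrier (coord_space K n) = {..<n} \<rightarrow>\<^sub>E carrier K"
  by (simp add: coord_space_def K.func_space_def)

lemma finite_coord_space: "finite (carrier K) \<Longrightarrow> finite (carrier (coord_space K n))"
  by (simp add: carrier_coord_space finite_PiE)

lemma card_coord_space: "card (carrier (coord_space K n)) = card (carrier K) ^ n"
  by (simp add: carrier_coord_space card_PiE)

lemma flat_subset: "flat K n m S \<Longrightarrow> S \<subseteq> carrier (coord_space K n)"
proof -
  assume "flat K n m S"
  then obtain W a where W: "VectorSpace.subspace K W (coord_space K n)"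
    and a: "a \<in> carrier (coord_space K n)" and S: "S = a <+\<^bsub>coord_space K n\<^esub> W"
    unfolding flat_def by blast
  interpret V: vectorspace K "coord_space K n" by (rule vectorspace_coord_space)
  have "W \<subseteq> carrier (coord_space K n)"
    using V.is_module[OF W] by (simp add: submodule_def)
  then show ?thesis unfolding S using a by (intro V.a_l_coset_subset_G)
qed

lemma card_flat:
  assumes "finite (carrier K)" "flat K n m S"
  shows "card S = card (carrier K) ^ m"
proof -
  obtain W a where W: "VectorSpace.subspace K W (coord_space K n)"
    and d: "vectorspace.dim K ((coord_space K n)\<lparr>carrier := W\<rparr>) = m"
    and a: "a \<in> carrier (coord_space K n)" and S: "S = a <+\<^bsub>coord_space K n\<^esub> W"
    using assms(2) unfolding flat_def by blast
  interpret V: vectorspace K "coord_space K n" by (rule vectorspace_coord_space)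
  have "W \<subseteq> carrier (coord_space K n)"
    using V.is_module[OF W] by (simp add: submodule_def)
  then show ?thesis
    using V.card_subspace_eq_power_dim[OF finite_coord_space[OF assms(1)] W] a
    by (simp add: S d V.card_a_l_coset)
qed

lemma finite_flats:
  assumes "finite (carrier K)"
  shows "finite {S. flat K n m S}"
  by (rule finite_subset[of _ "Pow (carrier (coord_space K n))"])
    (use flat_subset in blast, simp add: finite_coord_space[OF assms])

text \<open>A flat is the image of a pair of base point and direction. Every point of the flat may
  be its base point, so this overcounts, but for constant \<open>m\<close> the excess is harmless in
  the union bound.\<close>

lemma card_flats_le:
  assumes "finite (carrier K)"
  shows "card {S. flat K n m S} \<le> card (carrier K) ^ (n * (m + 1))"
proof -
  interpret V: vectorspace K "coord_space K n" by (rule vectorspace_coord_space)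
  let ?V = "carrier (coord_space K n)"
  let ?W = "{W. VectorSpace.subspace K W (coord_space K n)
              \<and> vectorspace.dim K ((coord_space K n)\<lparr>carrier := W\<rparr>) = m}"
  have fin: "finite ?V" by (rule finite_coord_space[OF assms])
  have "?W \<subseteq> Pow ?V"
    using V.is_module by (force simp: submodule_def)
  then have finW: "finite ?W" using fin by (meson finite_Pow_iff finite_subset)
  have "{S. flat K n m S} \<subseteq> (\<lambda>(a, W). a <+\<^bsub>coord_space K n\<^esub> W) ` (?V \<times> ?W)"
    unfolding flat_def by auto
  then have "card {S. flat K n m S} \<le> card (?V \<times> ?W)"
    using fin finW by (meson card_image_le card_mono finite_SigmaI finite_imageI le_trans)
  also have "\<dots> \<le> card ?V * card ?V ^ m"
    using V.card_subspaces_le[OF fin, of m] by (simp add: card_cartesian_product)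
  also have "\<dots> = card (carrier K) ^ (n * (m + 1))"
    by (simp add: card_coord_space power_mult power_add)
  finally show ?thesis .
qed

text \<open>The witness consists of the vectors whose coordinates vanish from index \<open>m\<close>
  on. Its dimension comes from counting its elements, which avoids exhibiting a basis.\<close>

lemma exists_subspace_dim:
  assumes "finite (carrier K)" "m \<le> n"
  shows "\<exists>W. VectorSpace.subspace K W (coord_space K n)
           \<and> vectorspace.dim K ((coord_space K n)\<lparr>carrier := W\<rparr>) = m"
proof -
  interpret V: vectorspace K "coord_space K n" by (rule vectorspace_coord_space)
  define W where "W = {x \<in> carrier (coord_space K n). \<forall>i\<in>{m..<n}. x i = \<zero>}"
  have sub: "VectorSpace.subspace K W (coord_space K n)"
  proof (intro VectorSpace.subspace.intro submodule.intro)
    show "vectorspace K (coord_space K n)" "Module.module K (coord_space K n)"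
      by unfold_locales
    show "\<zero>\<^bsub>coord_space K n\<^esub> \<in> W"
      by (auto simp: W_def coord_space_def K.func_space_def)
    show "v \<oplus>\<^bsub>coord_space K n\<^esub> w \<in> W" if "v \<in> W" "w \<in> W" for v w
      using that by (auto simp: W_def coord_space_def K.func_space_def PiE_iff)
    show "c \<odot>\<^bsub>coord_space K n\<^esub> v \<in> W" if "c \<in> carrier K" "v \<in> W" for c v
      using that by (auto simp: W_def coord_space_def K.func_space_def PiE_iff)
  qed (auto simp: W_def)
  have "bij_betw (\<lambda>x. restrict x {..<m}) W ({..<m} \<rightarrow>\<^sub>E carrier K)"
  \<comment> \<open>The inverse pads with zeros on the indices from \<open>m\<close> to
    \<open>n - 1\<close> and stays \<open>undefined\<close> outside \<open>{..<n}\<close>, as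
    extensionality demands.\<close>
  proof (rule bij_betw_byWitness[where f' = "\<lambda>x. \<lambda>i\<in>{..<n}. if i < m then x i else \<zero>"])
    show "\<forall>x\<in>W. (\<lambda>i\<in>{..<n}. if i < m then restrict x {..<m} i else \<zero>) = x"
      by (auto simp: W_def carrier_coord_space PiE_iff extensional_def fun_eq_iff)
    show "\<forall>x\<in>{..<m} \<rightarrow>\<^sub>E carrier K.
            restrict (\<lambda>i\<in>{..<n}. if i < m then x i else \<zero>) {..<m} = x"
    proof (intro ballI ext)
      fix x i assume "x \<in> {..<m} \<rightarrow>\<^sub>E carrier K"
      then show "restrict (\<lambda>i\<in>{..<n}. if i < m then x i else \<zero>) {..<m} i = x i"
        using assms(2) by (cases "i < m") (auto simp: PiE_arb[of x])
    qed
    show "(\<lambda>x. restrict x {..<m}) ` W \<subseteq> {..<m} \<rightarrow>\<^sub>E carrier K"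
      unfolding image_subset_iff restrict_PiE_iff
    proof (intro ballI)
      fix x i assume "x \<in> W" "i \<in> {..<m}"
      then show "x i \<in> carrier K"
        using assms(2) PiE_mem[of x "{..<n}" "\<lambda>_. carrier K" i]
        by (simp add: W_def carrier_coord_space)
    qed
    show "(\<lambda>x. \<lambda>i\<in>{..<n}. if i < m then x i else \<zero>) ` ({..<m} \<rightarrow>\<^sub>E carrier K) \<subseteq> W"
    proof (intro image_subsetI)
      fix x assume "x \<in> {..<m} \<rightarrow>\<^sub>E carrier K"
      then show "(\<lambda>i\<in>{..<n}. if i < m then x i else \<zero>) \<in> W"
        unfolding W_def carrier_coord_space mem_Collect_eq restrict_PiE_iff by auto
    qed
  qed
  then have "card W = card (carrier K) ^ m"
    by (simp add: bij_betw_same_card card_PiE)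
  \<comment> \<open>As \<open>K\<close> has at least two elements, the dimension can be read off the cardinality.\<close>
  moreover have "card {\<zero>, \<one>} \<le> card (carrier K)"
    using assms(1) by (intro card_mono) auto
  ultimately have "vectorspace.dim K ((coord_space K n)\<lparr>carrier := W\<rparr>) = m"
    using V.card_subspace_eq_power_dim[OF finite_coord_space[OF assms(1)] sub]
    by (simp add: power_inject_exp)
  with sub show ?thesis by blast
qed

text \<open>The cosets of one \<open>m\<close>-dimensional subspace partition the space, and
  Lagrange's theorem counts them.\<close>

lemma exists_parallel_flats:
  assumes "finite (carrier K)" "m \<le> n"
  shows "\<exists>\<F>. \<F> \<subseteq> {S. flat K n m S} \<and> disjoint \<F> \<and> card \<F> = card (carrier K) ^ (n - m)"
proof -
  interpret V: vectorspace K "coord_space K n" by (rule vectorspace_coord_space)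
  let ?V = "coord_space K n"
  have fin: "finite (carrier ?V)" by (rule finite_coord_space[OF assms(1)])
  obtain W where W: "VectorSpace.subspace K W ?V" "vectorspace.dim K (?V\<lparr>carrier := W\<rparr>) = m"
    using exists_subspace_dim[OF assms] by blast
  have WV: "submodule K W ?V" by (rule V.is_module[OF W(1)])
  \<comment> \<open>Lagrange's theorem and the disjointness of cosets are taken from the group
    \<open>add_monoid ?V\<close>, where they concern right cosets; flats are left translates, and
    commutativity identifies the two.\<close>
  let ?F = "rcosets\<^bsub>add_monoid ?V\<^esub> W"
  \<comment> \<open>A submodule is closed under scalar multiplication by minus one, which supplies
    the inverses that a subgroup needs.\<close>
  have neg: "\<ominus>\<^bsub>?V\<^esub> w \<in> W" if "w \<in> W" for w
  proof -
    have "(\<ominus> \<one>) \<odot>\<^bsub>?V\<^esub> w \<in> W" "w \<in> carrier ?V"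
      using that WV by (auto simp: submodule_def)
    then show ?thesis by (simp add: V.smult_minus_1)
  qed
  have sg: "subgroup W (add_monoid ?V)"
    using WV neg by (intro V.add.subgroupI) (auto simp: submodule_def a_inv_def)
  have "S \<in> {S. flat K n m S}" if "S \<in> ?F" for S
  proof -
    obtain a where a: "a \<in> carrier ?V" "S = W +>\<^bsub>?V\<^esub> a"
      using \<open>S \<in> ?F\<close> by (auto simp: RCOSETS_def a_r_coset_def)
    have "S = a <+\<^bsub>?V\<^esub> W"
      using a WV by (auto simp: submodule_def a_r_coset_def' a_l_coset_def' V.a_comm subset_iff)
    then show ?thesis using a W by (auto simp: flat_def)
  qed
  moreover have "disjoint ?F"
    using V.add.rcos_disjoint[OF sg] by (simp add: disjoint_def pairwise_def disjnt_def)
  moreover have "card ?F = card (carrier K) ^ (n - m)"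
  proof -
    have "card (carrier K) > 0" using assms(1) by (auto simp: card_gt_0_iff)
    moreover have "card ?F * card (carrier K) ^ m = card (carrier K) ^ (n - m) * card (carrier K) ^ m"
      using V.add.lagrange_finite[OF _ sg] fin V.card_subspace_eq_power_dim[OF fin W(1)] assms(2) W(2)
      by (simp add: Coset.order_def card_coord_space flip: power_add)
    ultimately show ?thesis by simp
  qed
  ultimately show ?thesis by blast
qed

end

section \<open>Independence properties of random subsets\<close>

lemma random_subset_Un:
  assumes "finite A" "finite B" "A \<inter> B = {}"
  shows "random_subset (A \<union> B) \<theta> =
    map_pmf (\<lambda>(X, Y). X \<union> Y) (pair_pmf (random_subset A \<theta>) (random_subset B \<theta>))"
proof -
  have "{x \<in> A \<union> B. if x \<in> A then f x else g x} = {x \<in> A. f x} \<union> {x \<in> B. g x}" for f g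
    using assms(3) by auto
  then show ?thesis
    unfolding random_subset_def Pi_pmf_union[OF assms] pair_map_pmf1 pair_map_pmf2 map_pmf_comp
    by (simp add: case_prod_unfold)
qed

lemma set_random_subset: "set_pmf (random_subset A \<theta>) \<subseteq> Pow A"
  by (auto simp: random_subset_def)

lemma prob_random_subset_empty:
  assumes "finite A" "0 \<le> \<theta>" "\<theta> \<le> 1"
  shows "measure_pmf.prob (random_subset A \<theta>) {X. X = {}} = (1 - \<theta>) ^ card A"
proof -
  have "measure_pmf.prob (random_subset A \<theta>) {X. X = {}}
      = measure_pmf.prob (Pi_pmf A False (\<lambda>_. bernoulli_pmf \<theta>)) (Pi A (\<lambda>_. {False}))"
    by (auto simp: random_subset_def Pi_def intro!: arg_cong2[where f = measure])
  also have "\<dots> = (1 - \<theta>) ^ card A"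
    using assms by (simp add: measure_Pi_pmf_Pi measure_pmf_single)
  finally show ?thesis .
qed

text \<open>Independence of what happens inside two disjoint sets, phrased with predicates so that
  it applies directly to events about one random subset of the union.\<close>

lemma prob_random_subset_Un:
  assumes "finite A" "finite B" "A \<inter> B = {}"
  shows "measure_pmf.prob (random_subset (A \<union> B) \<theta>) {X. P (X \<inter> A) \<and> Q (X \<inter> B)} =
    measure_pmf.prob (random_subset A \<theta>) {X. P X} * measure_pmf.prob (random_subset B \<theta>) {X. Q X}"
proof -
  let ?p = "pair_pmf (random_subset A \<theta>) (random_subset B \<theta>)"
  \<comment> \<open>The product rule for \<open>pair_pmf\<close> is applied to countable events;
    cutting down to the finite set \<open>Pow C\<close>, which carries all the mass, ensures
    this.\<close>
  have int: "measure_pmf.prob (random_subset C \<theta>) {X. R X}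
      = measure_pmf.prob (random_subset C \<theta>) ({X. R X} \<inter> Pow C)" for C :: "'a set" and R
    using set_random_subset[of C \<theta>]
    by (intro measure_pmf.finite_measure_eq_AE) (auto simp: AE_measure_pmf_iff)
  have "measure_pmf.prob (random_subset (A \<union> B) \<theta>) {X. P (X \<inter> A) \<and> Q (X \<inter> B)}
      = measure_pmf.prob ?p (({X. P X} \<inter> Pow A) \<times> ({X. Q X} \<inter> Pow B))"
    unfolding random_subset_Un[OF assms] measure_map_pmf
  proof (intro measure_pmf.finite_measure_eq_AE)
    \<comment> \<open>On the support, \<open>X\<close> and \<open>Y\<close> can be read off from
      their union because \<open>A\<close> and \<open>B\<close> are disjoint.\<close>
    have restr: "X \<subseteq> A \<and> Y \<subseteq> B \<and> (X \<union> Y) \<inter> A = X \<and> (X \<union> Y) \<inter> B = Y"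
      if "(X, Y) \<in> set_pmf ?p" for X Y
    proof -
      have "X \<subseteq> A" "Y \<subseteq> B"
        using that set_random_subset[of A \<theta>] set_random_subset[of B \<theta>] by auto
      then show ?thesis using assms(3) by auto
    qed
    show "AE z in ?p. (z \<in> (\<lambda>(X, Y). X \<union> Y) -` {X. P (X \<inter> A) \<and> Q (X \<inter> B)})
        = (z \<in> ({X. P X} \<inter> Pow A) \<times> ({X. Q X} \<inter> Pow B))"
      unfolding AE_measure_pmf_iff by (auto simp del: set_pair_pmf dest!: restr)
  qed auto
  also have "\<dots> = measure_pmf.prob (random_subset A \<theta>) ({X. P X} \<inter> Pow A)
      * measure_pmf.prob (random_subset B \<theta>) ({X. Q X} \<inter> Pow B)"
    using assms by (intro measure_pmf_prob_product countable_finite) auto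
  finally show ?thesis by (simp only: int[symmetric])
qed

text \<open>Only the part of \<open>X\<close> inside \<open>S\<close> matters: the independence rule
  is used with the trivial event on \<open>A - S\<close>.\<close>

lemma prob_random_subset_avoids:
  assumes "finite A" "S \<subseteq> A" "0 \<le> \<theta>" "\<theta> \<le> 1"
  shows "measure_pmf.prob (random_subset A \<theta>) {X. X \<inter> S = {}} = (1 - \<theta>) ^ card S"
proof -
  have "finite S" "S \<union> (A - S) = A" using assms by (auto intro: finite_subset)
  with prob_random_subset_Un[of S "A - S" \<theta> "\<lambda>X. X = {}" "\<lambda>_. True"] assms show ?thesis
    using prob_random_subset_empty[of S \<theta>] by simp
qed

text \<open>Splitting off one member \<open>S\<close> at a time factors the probability. The rest of
  the family lives in \<open>A - S\<close>, hence the induction generalises over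
  \<open>A\<close>.\<close>

lemma prob_random_subset_meets_disjoint:
  assumes "finite A" "\<Union>\<F> \<subseteq> A" "disjoint \<F>" "0 \<le> \<theta>" "\<theta> \<le> 1"
  shows "measure_pmf.prob (random_subset A \<theta>) {X. \<forall>S\<in>\<F>. X \<inter> S \<noteq> {}}
       = (\<Prod>S\<in>\<F>. 1 - (1 - \<theta>) ^ card S)"
proof -
  have "finite \<F>" using assms(1,2) by (meson finite_UnionD finite_subset)
  then show ?thesis using assms(1-3)
  proof (induction \<F> arbitrary: A rule: finite_induct)
    case empty
    then show ?case by simp
  next
    case (insert S \<F>)
    have S: "finite S" "S \<subseteq> A" "S \<union> (A - S) = A"
      using insert.prems by (auto intro: finite_subset)
    have disj: "T \<inter> S = {}" if "T \<in> \<F>" for T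
      using that insert.prems(3) insert.hyps(2) by (auto simp: disjoint_def)
    have "(\<forall>T\<in>insert S \<F>. X \<inter> T \<noteq> {}) \<longleftrightarrow> X \<inter> S \<noteq> {} \<and> (\<forall>T\<in>\<F>. (X \<inter> (A - S)) \<inter> T \<noteq> {})" for X
    proof -
      have "(X \<inter> (A - S)) \<inter> T = X \<inter> T" if "T \<in> \<F>" for T
        using disj[OF that] insert.prems(2) that by auto
      then show ?thesis by auto
    qed
    then have "measure_pmf.prob (random_subset A \<theta>) {X. \<forall>T\<in>insert S \<F>. X \<inter> T \<noteq> {}}
        = measure_pmf.prob (random_subset (S \<union> (A - S)) \<theta>)
            {X. X \<inter> S \<noteq> {} \<and> (\<forall>T\<in>\<F>. (X \<inter> (A - S)) \<inter> T \<noteq> {})}"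
      using S(3) by simp
    also have "\<dots> = measure_pmf.prob (random_subset S \<theta>) {X. X \<noteq> {}}
        * measure_pmf.prob (random_subset (A - S) \<theta>) {X. \<forall>T\<in>\<F>. X \<inter> T \<noteq> {}}"
      using S insert.prems(1)
      by (intro prob_random_subset_Un[where P = "\<lambda>X. X \<noteq> {}" and Q = "\<lambda>X. \<forall>T\<in>\<F>. X \<inter> T \<noteq> {}"]) auto
    also have "measure_pmf.prob (random_subset (A - S) \<theta>) {X. \<forall>T\<in>\<F>. X \<inter> T \<noteq> {}}
        = (\<Prod>T\<in>\<F>. 1 - (1 - \<theta>) ^ card T)"
      using insert.prems disj by (intro insert.IH) (auto simp: disjoint_def)
    also have "measure_pmf.prob (random_subset S \<theta>) {X. X \<noteq> {}} = 1 - (1 - \<theta>) ^ card S"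
      using measure_pmf.prob_compl[of "{X. X = {}}" "random_subset S \<theta>"]
        prob_random_subset_empty[OF S(1) assms(4,5)]
      by (simp add: Compl_eq_Diff_UNIV[symmetric] Collect_neg_eq)
    finally show ?case using insert.hyps by simp
  qed
qed

section \<open>Bounds for the blocking probability at fixed parameters\<close>

text \<open>Union bound over all flats, each of which is missed with the same probability.\<close>

lemma prob_blocking_set_ge:
  fixes K :: "('a, 'b) ring_scheme" and \<theta> :: real
  assumes "field K" "finite (carrier K)" "0 \<le> \<theta>" "\<theta> \<le> 1"
  shows "measure_pmf.prob (random_subset (carrier (coord_space K n)) \<theta>) {X. blocking_set K n m X}
       \<ge> 1 - card (carrier K) ^ (n * (m + 1)) * (1 - \<theta>) ^ (card (carrier K) ^ m)"
proof -
  let ?A = "carrier (coord_space K n)" and ?q = "card (carrier K)"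
  let ?p = "random_subset ?A \<theta>"
  let ?bad = "\<lambda>S. {X. X \<inter> S = {}}"
  have fin: "finite ?A" by (rule finite_coord_space[OF assms(1,2)])
  have "measure_pmf.prob ?p (- {X. blocking_set K n m X})
      \<le> measure_pmf.prob ?p (\<Union>S\<in>{S. flat K n m S}. ?bad S)"
    \<comment> \<open>The inclusion of events holds only almost surely, since
      \<open>blocking_set\<close> also requires \<open>X\<close> to lie in the space.\<close>
    using set_random_subset[of ?A \<theta>]
    by (intro measure_pmf.finite_measure_mono_AE) (auto simp: AE_measure_pmf_iff blocking_set_def)
  also have "\<dots> \<le> (\<Sum>S\<in>{S. flat K n m S}. measure_pmf.prob ?p (?bad S))"
    by (intro measure_pmf.finite_measure_subadditive_finite finite_flats assms) auto
  also have "\<dots> = (\<Sum>S\<in>{S. flat K n m S}. (1 - \<theta>) ^ (?q ^ m))"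
    using fin assms by (intro sum.cong)
      (auto simp: prob_random_subset_avoids flat_subset card_flat)
  also have "\<dots> = card {S. flat K n m S} * (1 - \<theta>) ^ (?q ^ m)"
    by simp
  also have "\<dots> \<le> ?q ^ (n * (m + 1)) * (1 - \<theta>) ^ (?q ^ m)"
    using card_flats_le[OF assms(1,2), of n m] assms
    by (intro mult_right_mono zero_le_power) (auto simp del: of_nat_power simp: of_nat_power[symmetric])
  finally show ?thesis
    using measure_pmf.prob_compl[of "{X. blocking_set K n m X}" ?p]
    by (simp add: Compl_eq_Diff_UNIV)
qed

text \<open>A blocking set meets in particular every member of a parallel family, and for those the
  events are independent.\<close>

lemma prob_blocking_set_le:
  fixes K :: "('a, 'b) ring_scheme" and \<theta> :: real
  assumes "field K" "finite (carrier K)" "m \<le> n" "0 \<le> \<theta>" "\<theta> \<le> 1"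
  shows "measure_pmf.prob (random_subset (carrier (coord_space K n)) \<theta>) {X. blocking_set K n m X}
       \<le> (1 - (1 - \<theta>) ^ (card (carrier K) ^ m)) ^ (card (carrier K) ^ (n - m))"
proof -
  let ?A = "carrier (coord_space K n)" and ?q = "card (carrier K)"
  obtain \<F> where \<F>: "\<F> \<subseteq> {S. flat K n m S}" "disjoint \<F>" "card \<F> = ?q ^ (n - m)"
    using exists_parallel_flats[OF assms(1-3)] by blast
  have "measure_pmf.prob (random_subset ?A \<theta>) {X. blocking_set K n m X}
      \<le> measure_pmf.prob (random_subset ?A \<theta>) {X. \<forall>S\<in>\<F>. X \<inter> S \<noteq> {}}"
    using \<F>(1) by (intro measure_pmf.finite_measure_mono) (auto simp: blocking_set_def)
  also have "\<dots> = (\<Prod>S\<in>\<F>. 1 - (1 - \<theta>) ^ card S)"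
    using \<F>(1) flat_subset[OF assms(1)]
    by (intro prob_random_subset_meets_disjoint finite_coord_space \<F>(2) assms) blast
  also have "\<dots> = (\<Prod>S\<in>\<F>. 1 - (1 - \<theta>) ^ (?q ^ m))"
    using \<F>(1) card_flat[OF assms(1,2)] by (intro prod.cong) auto
  finally show ?thesis using \<F>(3) by simp
qed

section \<open>Asymptotics and the threshold\<close>

text \<open>The logarithm of \<open>1 - x\<close> is at least \<open>- x - 2 * x\<^sup>2\<close>,
  and \<open>2 * x\<^sup>2\<close> is at most \<open>x\<close> on this range.\<close>

lemma exp_neg_double_le:
  fixes x :: real
  assumes "0 \<le> x" "x \<le> 1 / 2"
  shows "exp (- (2 * x)) \<le> 1 - x"
proof -
  have "- (2 * x) \<le> - x - 2 * x\<^sup>2"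
    using mult_left_mono[OF assms(2,1)] by (simp add: power2_eq_square)
  also have "\<dots> \<le> ln (1 - x)" using ln_one_minus_pos_lower_bound[of x] assms by simp
  finally show ?thesis using assms by (simp add: ln_ge_iff)
qed

theorem theorem1p8:
  fixes m :: nat
    and n q :: "nat \<Rightarrow> nat"
    and F :: "nat \<Rightarrow> 'a ring"
    and \<theta> :: "nat \<Rightarrow> real"
  assumes "1 \<le> m"
    and "\<And>k. real m < real (n k) / 2"
    and "\<And>k. primepow (q k)"
    and "\<And>k. field (F k)"
    and "\<And>k. card (carrier (F k)) = q k"
    and "filterlim q at_top sequentially"
    and "(\<lambda>k. real (n k)) \<in> o(\<lambda>k. real (q k) ^ m / ln (real (q k)))"
    and "\<And>k. 0 \<le> \<theta> k \<and> \<theta> k \<le> 1"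
  shows
    "(\<theta> \<in> o(\<lambda>k. real (n k) / real (q k) ^ m * ln (real (q k))) \<longrightarrow>
        (\<lambda>k. measure_pmf.prob (random_subset (carrier (coord_space (F k) (n k))) (\<theta> k))
               {X. blocking_set (F k) (n k) m X}) \<longlonglongrightarrow> 0)
     \<and>
     (\<theta> \<in> \<omega>(\<lambda>k. real (n k) / real (q k) ^ m * ln (real (q k))) \<longrightarrow>
        (\<lambda>k. measure_pmf.prob (random_subset (carrier (coord_space (F k) (n k))) (\<theta> k))
               {X. blocking_set (F k) (n k) m X}) \<longlonglongrightarrow> 1)"
proof -
  define P where "P = (\<lambda>k. measure_pmf.prob (random_subset (carrier (coord_space (F k) (n k))) (\<theta> k))
               {X. blocking_set (F k) (n k) m X})"
  define L where "L = (\<lambda>k. ln (real (q k)))"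
  have q: "1 < q k" for k using primepow_gt_Suc_0[OF assms(3)] by simp
  have L: "0 < L k" for k using q[of k] by (simp add: L_def)
  have n: "2 * real m \<le> real (n k)" "m \<le> n k" "1 \<le> real (n k)" for k
    using assms(2)[of k] assms(1) by linarith+
  have \<theta>: "0 \<le> \<theta> k" "\<theta> k \<le> 1" for k using assms(8) by auto
  \<comment> \<open>An infinite carrier would have \<open>card\<close> equal to 0, whereas
    \<open>q k\<close> exceeds 1.\<close>
  have fin: "finite (carrier (F k))" for k
    using q[of k] assms(5)[of k] by (metis card.infinite less_zeroE)
  \<comment> \<open>Powers of \<open>q k\<close> become exponentials, so that comparing products
    reduces to comparing exponents in units of \<open>L k\<close>.\<close>
  have qpow: "real (q k) ^ j = exp (real j * L k)" for k j
    using q[of k] by (simp only: exp_of_nat_mult L_def) simp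
  have q_lim: "filterlim (\<lambda>k. real (q k)) at_top sequentially"
    using assms(6) filterlim_compose filterlim_real_sequentially by blast
  have "P \<longlonglongrightarrow> 0" if small: "\<theta> \<in> o(\<lambda>k. real (n k) / real (q k) ^ m * ln (real (q k)))"
  proof -
    \<comment> \<open>With 1/8, the miss probability of a flat is at least
      \<open>exp (- (n k * L k / 4))\<close> after the doubling in \<open>exp_neg_double_le\<close>.
      Against at least \<open>exp (n k * L k / 2)\<close> parallel flats, a factor
      \<open>exp (n k * L k / 4)\<close> remains.\<close>
    have "\<forall>\<^sub>F k in sequentially. norm (\<theta> k)
        \<le> 1 / 8 * norm (real (n k) / real (q k) ^ m * ln (real (q k)))"
      by (rule landau_o.smallD[OF small]) simp
    moreover have "\<forall>\<^sub>F k in sequentially. norm (real (n k))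
        \<le> 1 * norm (real (q k) ^ m / ln (real (q k)))"
      by (rule landau_o.smallD[OF assms(7)]) simp
    ultimately have upper: "\<forall>\<^sub>F k in sequentially. P k \<le> exp (- (real (q k) powr (1 / 4)))"
    proof eventually_elim
      case (elim k)
      let ?M = "real (q k) ^ m" and ?N = "real (q k) ^ (n k - m)"
      have M: "0 < ?M" using q[of k] by simp
      have \<theta>M: "\<theta> k * ?M \<le> real (n k) * L k / 8"
        using elim(1) L[of k] M \<theta>[of k] by (simp add: L_def field_simps)
      have "real (n k) * L k \<le> ?M"
        using elim(2) L[of k] M by (simp add: L_def field_simps)
      \<comment> \<open>Here the growth condition on \<open>n\<close> enters: it puts
        \<open>\<theta> k\<close> in the range of \<open>exp_neg_double_le\<close>.\<close>
      then have "\<theta> k * ?M \<le> 1 / 2 * ?M" using \<theta>M M by linarith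
      then have "\<theta> k \<le> 1 / 2" using M mult_right_le_imp_le by blast
      then have "exp (- (2 * \<theta> k)) ^ (q k ^ m) \<le> (1 - \<theta> k) ^ (q k ^ m)"
        using \<theta> by (intro power_mono exp_neg_double_le) auto
      moreover have "exp (- (2 * \<theta> k)) ^ (q k ^ m) = exp (- (2 * (\<theta> k * ?M)))"
        by (simp add: exp_of_nat_mult[symmetric] mult_ac)
      moreover have "exp (- (real (n k) * L k / 4)) \<le> exp (- (2 * (\<theta> k * ?M)))"
        using \<theta>M by simp
      ultimately have *: "exp (- (real (n k) * L k / 4)) \<le> (1 - \<theta> k) ^ (q k ^ m)"
        by linarith
      have "real (q k) powr (1 / 4) = exp (L k / 4)"
        using q[of k] by (simp add: powr_def L_def)
      also have "\<dots> \<le> exp (real (n k) * L k / 4)"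
        using n(3)[of k] L[of k] by simp
      also have "\<dots> = exp (real (n k) / 2 * L k) * exp (- (real (n k) * L k / 4))"
        by (simp flip: exp_add)
      also have "\<dots> \<le> ?N * (1 - \<theta> k) ^ (q k ^ m)"
      proof (rule mult_mono[OF _ *])
        \<comment> \<open>The assumption that \<open>m\<close> is below half of \<open>n k\<close>
          gives \<open>n k - m\<close> at least \<open>n k / 2\<close>.\<close>
        have "real (n k) / 2 * L k \<le> real (n k - m) * L k"
          using n[of k] L[of k] by (intro mult_right_mono) (simp_all add: of_nat_diff)
        then show "exp (real (n k) / 2 * L k) \<le> ?N" by (simp add: qpow)
      qed simp_all
      finally have N: "real (q k) powr (1 / 4) \<le> ?N * (1 - \<theta> k) ^ (q k ^ m)" .
      have "P k \<le> (1 - (1 - \<theta> k) ^ (q k ^ m)) ^ (q k ^ (n k - m))"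
        using prob_blocking_set_le[OF assms(4) fin n(2) \<theta>, of k] by (simp add: P_def assms(5))
      \<comment> \<open>This is \<open>1 - x \<le> exp (- x)\<close> with \<open>x\<close> the miss
        probability; the exponent becomes the expected number of missed flats in the family.\<close>
      also have "\<dots> \<le> exp (- ((1 - \<theta> k) ^ (q k ^ m))) ^ (q k ^ (n k - m))"
        using exp_ge_add_one_self[of "- ((1 - \<theta> k) ^ (q k ^ m))"] \<theta>[of k]
        by (intro power_mono) (simp_all add: power_le_one)
      also have "\<dots> = exp (- (?N * (1 - \<theta> k) ^ (q k ^ m)))"
        by (simp add: exp_of_nat_mult[symmetric])
      finally show ?case using N by (smt (verit) exp_le_cancel_iff)
    qed
    have lower: "\<forall>\<^sub>F k in sequentially. 0 \<le> P k" by (simp add: P_def)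
    have lim: "(\<lambda>k. exp (- (real (q k) powr (1 / 4)))) \<longlonglongrightarrow> 0"
      by (rule filterlim_compose[OF _ q_lim]) real_asymp
    show ?thesis by (rule tendsto_sandwich[OF lower upper tendsto_const lim])
  qed
  moreover have "P \<longlonglongrightarrow> 1" if large: "\<theta> \<in> \<omega>(\<lambda>k. real (n k) / real (q k) ^ m * ln (real (q k)))"
  proof -
    \<comment> \<open>In the constant \<open>m + 2\<close>, the part \<open>m + 1\<close> cancels
      the number of flats, and the remaining 1 leaves \<open>exp (- (n k * L k))\<close>, which is
      at most \<open>1 / q k\<close>.\<close>
    have "\<forall>\<^sub>F k in sequentially. norm (\<theta> k)
        \<ge> (real m + 2) * norm (real (n k) / real (q k) ^ m * ln (real (q k)))"
      by (rule landau_omega.smallD[OF large]) simp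
    then have lower: "\<forall>\<^sub>F k in sequentially. 1 - 1 / real (q k) \<le> P k"
    proof eventually_elim
      case (elim k)
      let ?M = "real (q k) ^ m"
      have M: "0 < ?M" using q[of k] by simp
      have \<theta>M: "(real m + 2) * (real (n k) * L k) \<le> \<theta> k * ?M"
        using elim L[of k] M \<theta>[of k] by (simp add: L_def field_simps)
      have "(1 - \<theta> k) ^ (q k ^ m) \<le> exp (- \<theta> k) ^ (q k ^ m)"
        using exp_ge_add_one_self[of "- \<theta> k"] \<theta>[of k] by (intro power_mono) simp_all
      also have "\<dots> = exp (- (\<theta> k * ?M))"
        by (simp add: exp_of_nat_mult[symmetric] mult_ac)
      finally have "real (q k) ^ (n k * (m + 1)) * (1 - \<theta> k) ^ (q k ^ m)
          \<le> exp (real (n k * (m + 1)) * L k) * exp (- (\<theta> k * ?M))"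
        by (simp only: qpow) (rule mult_left_mono, simp_all)
      also have "\<dots> = exp ((real m + 1) * (real (n k) * L k) - \<theta> k * ?M)"
        by (simp add: algebra_simps flip: exp_add)
      also have "\<dots> \<le> exp (- L k)"
      proof -
        have "L k \<le> real (n k) * L k" using n(3)[of k] L[of k] by simp
        then show ?thesis using \<theta>M by (simp add: algebra_simps)
      qed
      also have "\<dots> = 1 / real (q k)" using q[of k] by (simp add: L_def exp_minus inverse_eq_divide)
      finally show ?case
        using prob_blocking_set_ge[OF assms(4)[of k] fin \<theta>[of k], of "n k" m]
        unfolding P_def assms(5) of_nat_power by linarith
    qed
    have upper: "\<forall>\<^sub>F k in sequentially. P k \<le> 1" by (simp add: P_def)
    have lim: "(\<lambda>k. 1 - 1 / real (q k)) \<longlonglongrightarrow> 1"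
      by (rule filterlim_compose[OF _ q_lim]) real_asymp
    show ?thesis by (rule tendsto_sandwich[OF lower upper lim tendsto_const])
  qed
  ultimately show ?thesis unfolding P_def by blast
qed

end
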